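(* Let $\mu:(V_1,F_1)\to(V_2,F_2)$ be a submersion of Minkowski normed spaces with corresponding nonlinear lift $\mathbf h:V_2\to V_1$. For $u\in V_1\setminus\{0\}$ and $v\in V_2\setminus\{0\}$ let $g^1_u$ and $g^2_v$ be the inner products on $V_1$ and $V_2$ associated with $F_1$ and $F_2$. Then, for each $v\in V_2\setminus\{0\}$: (i) the tangent space $T_{\mathbf h(v)}(\mathrm{Im}\,\mathbf h)$ to the horizontal cone, regarded as a subspace of $V_1$, is the horizontal subspace of $g^1_{\mathbf h(v)}$ in $V_1$ (i.e. the $g^1_{\mathbf h(v)}$-orthogonal complement of $\ker\mu$); (ii) $\mu$ is a submersion between the Euclidean spaces $(V_1,g^1_{\mathbf h(v)})$ and $(V_2,g^2_v)$; (iii) the linear map $T_v\mathbf h:V_2\to V_1$ is the nonlinear lift that corresponds to the Euclidean submersion of (ii), regarded as a Minkowski submersion with respect to the norms induced by $g^1_{\mathbf h(v)}$ and $g^2_v$.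
   Context: Vector spaces are real and finite-dimensional; tangent spaces of a vector space $V$ are identified with $V$, and $T_u\mu$ with $\mu$. A Minkowski norm $F$ on $V$ is a non-negative real-valued function that is $C^\infty$ on $V\setminus\{0\}$, positively homogeneous ($F(\lambda u)=\lambda F(u)$ for $\lambda>0$, with $F(0)=0$), and strongly convex: the Hessian of $\mathbf E=\frac12F^2$ is positive definite at each $u\in V\setminus\{0\}$. For $u\ne0$ the associated inner product on $V$ is $g_u(x,y)=\frac{\partial^2\mathbf E}{\partial u^a\partial u^b}(u)\,x^ay^b$ in linear coordinates. A surjective linear map $\mu:V_1\to V_2$ is a submersion of Minkowski normed spaces if $\mu(\{F_1\le1\})=\{F_2\le1\}$; equivalently $F_2(v)=\inf\{F_1(u):\mu(u)=v\}$ for all $v$. The corresponding nonlinear lift $\mathbf h:V_2\to V_1$ assigns to $v$ the unique vector $\mathbf h(v)\in\mu^{-1}(v)$ with $F_1(\mathbf h(v))=F_2(v)$, i.e. the unique minimizer of $F_1$ on $\mu^{-1}(v)$; it is continuous, smooth on $V_2\setminus\{0\}$, positively homogeneous of degree 1, and satisfies $\mu\circ\mathbf h=\mathrm{id}$. Its image $\mathrm{Im}\,\mathbf h$ is called the horizontal cone. For a surjective linear map $\mu$ between Euclidean vector spaces $(V_1,\langle,\rangle_1)$ and $(V_2,\langle,\rangle_2)$, the horizontal subspace $\mathcal H$ of $\langle,\rangle_1$ is the orthogonal complement of $\ker\mu$ in $V_1$; $\mu$ is a submersion between Euclidean spaces if $\langle u,\tilde u\rangle_1=\langle\mu(u),\mu(\tilde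 u)\rangle_2$ for all $u,\tilde u\in\mathcal H$. A Euclidean submersion is a Minkowski submersion with respect to the norms $\sqrt{\langle u,u\rangle_i}$, hence has a corresponding nonlinear lift, namely the map assigning to each $v\in V_2$ the unique vector of $\mu^{-1}(v)$ at which $\sqrt{\langle u,u\rangle_1}$ attains its minimum over $u\in\mu^{-1}(v)$, this minimum being equal to $\sqrt{\langle v,v\rangle_2}$. *)

theory Defs
  imports "HOL-Analysis.Analysis"
begin

text \<open>
  Finite-dimensional real vector spaces are rendered by types of class
  \<^class>\<open>euclidean_space\<close>. Their built-in inner product only supplies linear
  coordinates and the topology; it is unrelated to the Minkowski norms and to the inner
  products derived from them.
\<close>

text \<open>
  \<open>C\<^sup>n\<close> maps on an open set: all iterated directional derivatives up to order \<open>n\<close> exist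
  and are continuous. The definition is meant for open \<open>S\<close> only.
\<close>

primrec higher_differentiable_on ::
  "'a::real_normed_vector set \<Rightarrow> ('a \<Rightarrow> 'b::real_normed_vector) \<Rightarrow> nat \<Rightarrow> bool" where
  "higher_differentiable_on S f 0 \<longleftrightarrow> continuous_on S f"
| "higher_differentiable_on S f (Suc n) \<longleftrightarrow>
     (\<forall>x\<in>S. f differentiable (at x)) \<and>
     (\<forall>v. higher_differentiable_on S (\<lambda>x. frechet_derivative f (at x) v) n)"

definition smooth_on ::
  "'a::real_normed_vector set \<Rightarrow> ('a \<Rightarrow> 'b::real_normed_vector) \<Rightarrow> bool" where
  "smooth_on S f \<longleftrightarrow> (\<forall>n. higher_differentiable_on S f n)"

definition energy :: "('a::euclidean_space \<Rightarrow> real) \<Rightarrow> 'a \<Rightarrow> real" where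
  "energy F u = (F u)\<^sup>2 / 2"

definition partial_deriv :: "'a::euclidean_space \<Rightarrow> ('a \<Rightarrow> real) \<Rightarrow> 'a \<Rightarrow> real" where
  "partial_deriv a f u = frechet_derivative f (at u) a"

text \<open>
  The form \<open>g\<^sub>u\<close>, in the linear coordinates given by \<^const>\<open>Basis\<close>. It is meant for
  \<open>u \<noteq> 0\<close>.
\<close>

definition fundamental_form :: "('a::euclidean_space \<Rightarrow> real) \<Rightarrow> 'a \<Rightarrow> 'a \<Rightarrow> 'a \<Rightarrow> real" where
  "fundamental_form F u x y =
     (\<Sum>a\<in>Basis. \<Sum>b\<in>Basis.
        partial_deriv a (partial_deriv b (energy F)) u * (x \<bullet> a) * (y \<bullet> b))"

definition minkowski_norm :: "('a::euclidean_space \<Rightarrow> real) \<Rightarrow> bool" where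
  "minkowski_norm F \<longleftrightarrow>
     (\<forall>u. 0 \<le> F u) \<and>
     smooth_on (UNIV - {0}) F \<and>
     F 0 = 0 \<and> (\<forall>c>0. \<forall>u. F (c *\<^sub>R u) = c * F u) \<and>
     (\<forall>u. u \<noteq> 0 \<longrightarrow> (\<forall>x. x \<noteq> 0 \<longrightarrow> 0 < fundamental_form F u x x))"

definition minkowski_submersion ::
  "('a::euclidean_space \<Rightarrow> real) \<Rightarrow> ('b::euclidean_space \<Rightarrow> real) \<Rightarrow> ('a \<Rightarrow> 'b) \<Rightarrow> bool" where
  "minkowski_submersion F1 F2 \<mu> \<longleftrightarrow>
     minkowski_norm F1 \<and> minkowski_norm F2 \<and> linear \<mu> \<and> surj \<mu> \<and>
     \<mu> ` {u. F1 u \<le> 1} = {v. F2 v \<le> 1}"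

definition nonlinear_lift ::
  "('a::euclidean_space \<Rightarrow> real) \<Rightarrow> ('b::euclidean_space \<Rightarrow> real) \<Rightarrow> ('a \<Rightarrow> 'b) \<Rightarrow> ('b \<Rightarrow> 'a) \<Rightarrow> bool"
  where
  "nonlinear_lift F1 F2 \<mu> h \<longleftrightarrow>
     (\<forall>v. \<mu> (h v) = v \<and> F1 (h v) = F2 v \<and>
          (\<forall>u. \<mu> u = v \<and> F1 u = F2 v \<longrightarrow> u = h v))"

text \<open>
  Velocities at \<open>p\<close> of smooth curves lying in \<open>S\<close>; at a point near which \<open>S\<close> is an embedded
  submanifold this is its tangent space, regarded as a subspace of the ambient space.
\<close>

definition tangent_space :: "'a::euclidean_space set \<Rightarrow> 'a \<Rightarrow> 'a set" where
  "tangent_space S p =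
     {w. \<exists>\<gamma> e. 0 < e \<and> smooth_on {-e<..<e} \<gamma> \<and> \<gamma> ` {-e<..<e} \<subseteq> S \<and>
          \<gamma> (0::real) = p \<and> (\<gamma> has_vector_derivative w) (at 0)}"

definition inner_product :: "('a::euclidean_space \<Rightarrow> 'a \<Rightarrow> real) \<Rightarrow> bool" where
  "inner_product g \<longleftrightarrow>
     bilinear g \<and> (\<forall>x y. g x y = g y x) \<and> (\<forall>x. x \<noteq> 0 \<longrightarrow> 0 < g x x)"

definition induced_norm :: "('a::euclidean_space \<Rightarrow> 'a \<Rightarrow> real) \<Rightarrow> 'a \<Rightarrow> real" where
  "induced_norm g x = sqrt (g x x)"

definition horizontal_subspace ::
  "('a::euclidean_space \<Rightarrow> 'a \<Rightarrow> real) \<Rightarrow> ('a \<Rightarrow> 'b::euclidean_space) \<Rightarrow> 'a set" where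
  "horizontal_subspace g \<mu> = {x. \<forall>y. \<mu> y = 0 \<longrightarrow> g x y = 0}"

definition euclidean_submersion ::
  "('a::euclidean_space \<Rightarrow> 'a \<Rightarrow> real) \<Rightarrow> ('b::euclidean_space \<Rightarrow> 'b \<Rightarrow> real) \<Rightarrow> ('a \<Rightarrow> 'b) \<Rightarrow> bool"
  where
  "euclidean_submersion g1 g2 \<mu> \<longleftrightarrow>
     inner_product g1 \<and> inner_product g2 \<and> linear \<mu> \<and> surj \<mu> \<and>
     (\<forall>x\<in>horizontal_subspace g1 \<mu>. \<forall>y\<in>horizontal_subspace g1 \<mu>. g1 x y = g2 (\<mu> x) (\<mu> y))"

end

theory Submission
  imports Defs
begin

text \<open>
  Write \<open>E\<^sub>i = F\<^sub>i\<^sup>2/2\<close>. The function \<open>E\<^sub>1 - E\<^sub>2 \<circ> \<mu>\<close> is nonnegative and vanishes on the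
  horizontal cone, so \<open>dE\<^sub>1(h v) = dE\<^sub>2(v) \<circ> \<mu>\<close> for \<open>v \<noteq> 0\<close>. Differentiating this along
  \<open>L = dh(v)\<close> gives \<open>g\<^sub>1(L b, z) = g\<^sub>2(b, \<mu> z)\<close>, which together with \<open>\<mu> \<circ> L = id\<close> contains the
  linear algebra of all three claims. That \<open>h\<close> is smooth follows from the inverse function
  theorem: by convexity \<open>h\<close> consists exactly of the critical points of \<open>E\<^sub>1\<close> along the fibres of
  \<open>\<mu>\<close>, and these are cut out by a local diffeomorphism. All orders of smoothness come from
  the equation \<open>dh(w) c = G\<^sub>c(h w)\<close> with smooth vector fields \<open>G\<^sub>c\<close>.
\<close>

subsection \<open>Calculus of \<open>C\<^sup>n\<close> maps\<close>

lemma higher_differentiable_on_has_derivative: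
  assumes "higher_differentiable_on S f (Suc n)" "x \<in> S"
  shows "(f has_derivative frechet_derivative f (at x)) (at x)"
  using assms by (simp add: frechet_derivative_works)

text \<open>On an open set the values near a point determine the derivative there, so agreement of
  the maps passes to all directional derivatives.\<close>

lemma higher_differentiable_on_cong:
  assumes "open S" "\<And>x. x \<in> S \<Longrightarrow> f x = g x" "higher_differentiable_on S f n"
  shows "higher_differentiable_on S g n"
  using assms(2,3)
proof (induction n arbitrary: f g)
  case 0
  then show ?case by (simp cong: continuous_on_cong)
next
  case (Suc n)
  have "(g has_derivative frechet_derivative f (at x)) (at x)" if "x \<in> S" for x
    using has_derivative_transform_within_open
      [OF higher_differentiable_on_has_derivative[OF Suc.prems(2) that] \<open>open S\<close> that Suc.prems(1)]
    by simp
  then have der: "g differentiable at x" "frechet_derivative f (at x) = frechet_derivative g (at x)"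
    if "x \<in> S" for x
    using that frechet_derivative_at differentiable_def by blast+
  have "higher_differentiable_on S (\<lambda>x. frechet_derivative g (at x) v) n" for v
    by (rule Suc.IH[of "\<lambda>x. frechet_derivative f (at x) v"]) (use Suc.prems der in auto)
  with der show ?case by simp
qed

text \<open>Working introduction rule: any explicit formula for the derivative will do, since it
  agrees with \<open>frechet_derivative\<close> throughout the open set.\<close>

lemma higher_differentiable_on_SucI:
  assumes "open S" "\<And>x. x \<in> S \<Longrightarrow> (f has_derivative f' x) (at x)"
    and "\<And>v. higher_differentiable_on S (\<lambda>x. f' x v) n"
  shows "higher_differentiable_on S f (Suc n)"
proof -
  have "f differentiable at x" "f' x = frechet_derivative f (at x)" if "x \<in> S" for x
    using assms(2)[OF that] frechet_derivative_at differentiable_def by blast+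
  then show ?thesis
    using higher_differentiable_on_cong[OF \<open>open S\<close> _ assms(3)] by auto
qed

lemma higher_differentiable_on_subset:
  "higher_differentiable_on S f n \<Longrightarrow> T \<subseteq> S \<Longrightarrow> higher_differentiable_on T f n"
  by (induction n arbitrary: f) (auto intro: continuous_on_subset)

lemma higher_differentiable_on_imp_continuous_on:
  "higher_differentiable_on S f n \<Longrightarrow> continuous_on S f"
  by (cases n) (auto intro!: continuous_at_imp_continuous_on differentiable_imp_continuous_within)

lemma higher_differentiable_on_SucD:
  "higher_differentiable_on S f (Suc n) \<Longrightarrow> higher_differentiable_on S f n"
proof (induction n arbitrary: f)
  case 0
  then show ?case using higher_differentiable_on_imp_continuous_on by fastforce
next
  case (Suc n)
  then show ?case by (metis higher_differentiable_on.simps(2))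
qed

lemma higher_differentiable_on_const [simp]: "higher_differentiable_on S (\<lambda>x. c) n"
  by (induction n arbitrary: c) auto

lemma higher_differentiable_on_bounded_linear:
  assumes "open S" "bounded_linear L" "higher_differentiable_on S f n"
  shows "higher_differentiable_on S (\<lambda>x. L (f x)) n"
  using assms(3)
proof (induction n arbitrary: f)
  case 0
  then show ?case
    using assms(2) by (auto intro: linear_continuous_on_compose bounded_linear.continuous_on)
next
  case (Suc n)
  show ?case
  proof (rule higher_differentiable_on_SucI[OF \<open>open S\<close>])
    show "((\<lambda>x. L (f x)) has_derivative (\<lambda>v. L (frechet_derivative f (at x) v))) (at x)"
      if "x \<in> S" for x
      by (rule bounded_linear.has_derivative[OF assms(2)
            higher_differentiable_on_has_derivative[OF Suc.prems that]])
  qed (use Suc in auto)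
qed

lemma higher_differentiable_on_add:
  assumes "open S" "higher_differentiable_on S f n" "higher_differentiable_on S g n"
  shows "higher_differentiable_on S (\<lambda>x. f x + g x) n"
  using assms(2,3)
proof (induction n arbitrary: f g)
  case 0
  then show ?case by (auto intro: continuous_on_add)
next
  case (Suc n)
  show ?case
  proof (rule higher_differentiable_on_SucI[OF \<open>open S\<close>])
    show "((\<lambda>x. f x + g x) has_derivative
        (\<lambda>v. frechet_derivative f (at x) v + frechet_derivative g (at x) v)) (at x)"
      if "x \<in> S" for x
      using that Suc.prems by (intro has_derivative_add higher_differentiable_on_has_derivative)
  qed (use Suc in auto)
qed

lemma higher_differentiable_on_sum:
  assumes "open S" "\<And>i. i \<in> I \<Longrightarrow> higher_differentiable_on S (f i) n"
  shows "higher_differentiable_on S (\<lambda>x. \<Sum>i\<in>I. f i x) n"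
  using assms(2)
  by (induction I rule: infinite_finite_induct) (auto intro: higher_differentiable_on_add[OF \<open>open S\<close>])

text \<open>Leibniz rule: each summand of the derivative pairs one factor with a derivative of the
  other, so the induction applies after lowering the order of the undifferentiated factor.\<close>

lemma higher_differentiable_on_bounded_bilinear:
  assumes "open S" "bounded_bilinear B" "higher_differentiable_on S f n" "higher_differentiable_on S g n"
  shows "higher_differentiable_on S (\<lambda>x. B (f x) (g x)) n"
  using assms(3,4)
proof (induction n arbitrary: f g)
  case 0
  then show ?case using bounded_bilinear.continuous_on[OF assms(2)] by auto
next
  case (Suc n)
  show ?case
  proof (rule higher_differentiable_on_SucI[OF \<open>open S\<close>])
    show "((\<lambda>x. B (f x) (g x)) has_derivative
        (\<lambda>v. B (f x) (frechet_derivative g (at x) v) + B (frechet_derivative f (at x) v) (g x))) (at x)"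
      if "x \<in> S" for x
      using that Suc.prems
      by (intro bounded_bilinear.FDERIV[OF assms(2)] higher_differentiable_on_has_derivative)
    show "higher_differentiable_on S
        (\<lambda>x. B (f x) (frechet_derivative g (at x) v) + B (frechet_derivative f (at x) v) (g x)) n" for v
      using Suc.prems Suc.prems[THEN higher_differentiable_on_SucD]
      by (intro higher_differentiable_on_add[OF \<open>open S\<close>] Suc.IH) auto
  qed
qed

lemmas higher_differentiable_on_scaleR =
  higher_differentiable_on_bounded_bilinear[OF _ bounded_bilinear_scaleR]
lemmas higher_differentiable_on_mult =
  higher_differentiable_on_bounded_bilinear[OF _ bounded_bilinear_mult]

lemma higher_differentiable_on_linear:
  assumes "open S" "bounded_linear L"
  shows "higher_differentiable_on S L n"
proof (cases n)
  case 0
  then show ?thesis using assms(2) by (simp add: linear_continuous_on)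
next
  case (Suc m)
  show ?thesis
    unfolding Suc
    by (rule higher_differentiable_on_SucI[OF \<open>open S\<close>, of L "\<lambda>_. L"])
      (use assms(2) in \<open>auto intro: bounded_linear_imp_has_derivative\<close>)
qed

text \<open>The exponent is kept general in the induction because differentiation replaces
  \<open>a\<close> by \<open>a - 1\<close>. The case \<open>a = 1 / 2\<close> later gives square
  roots.\<close>

lemma higher_differentiable_on_powr:
  fixes f :: "'a::real_normed_vector \<Rightarrow> real"
  assumes "open S" "\<And>x. x \<in> S \<Longrightarrow> 0 < f x" "higher_differentiable_on S f n"
  shows "higher_differentiable_on S (\<lambda>x. f x powr a) n"
  using assms(3)
proof (induction n arbitrary: a)
  case 0
  then show ?case using assms(2) by (fastforce intro!: continuous_on_powr)
next
  case (Suc n)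
  show ?case
  proof (rule higher_differentiable_on_SucI[OF \<open>open S\<close>])
    show "((\<lambda>x. f x powr a) has_derivative
        (\<lambda>v. a * f x powr (a - 1) * frechet_derivative f (at x) v)) (at x)"
      if "x \<in> S" for x
      using has_derivative_powr[OF higher_differentiable_on_has_derivative[OF Suc.prems that]
          has_derivative_const[of a] assms(2)[OF that]] assms(2)[OF that]
      by (simp add: powr_diff powr_one field_simps)
    show "higher_differentiable_on S
        (\<lambda>x. a * f x powr (a - 1) * frechet_derivative f (at x) v) n" for v
      using Suc.prems higher_differentiable_on_SucD[OF Suc.prems]
      by (intro higher_differentiable_on_mult[OF \<open>open S\<close>] Suc.IH) auto
  qed
qed

section \<open>Second differences and symmetry of second derivatives\<close>

lemma has_real_derivative_along_line:
  fixes f :: "'a::real_normed_vector \<Rightarrow> real"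
  assumes "(f has_derivative f') (at (u + s *\<^sub>R y))"
  shows "((\<lambda>s. f (u + s *\<^sub>R y)) has_real_derivative f' y) (at s)"
proof -
  have "((\<lambda>s. u + s *\<^sub>R y) has_derivative (\<lambda>h. h *\<^sub>R y)) (at s)"
    by (auto intro!: derivative_eq_intros)
  from has_derivative_compose[OF this assms] show ?thesis
    using linear_cmul[OF has_derivative_linear[OF assms]]
    by (simp add: has_field_derivative_def mult_commute_abs)
qed

text \<open>Two mean value steps: first in direction \<open>y\<close> for the difference of
  \<open>f\<close> along two parallel segments, then in direction \<open>x\<close> for the
  derivative of \<open>f\<close> in direction \<open>y\<close>. The bound on \<open>t\<close> keeps
  the parallelogram inside the ball.\<close>

lemma second_difference_mvt:
  fixes f :: "'a::real_normed_vector \<Rightarrow> real"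
  assumes f: "higher_differentiable_on (ball u r) f (Suc (Suc n))"
    and t: "0 < t" "t * (norm x + norm y) < r"
  obtains p where "p \<in> ball u r"
    "f (u + t *\<^sub>R x + t *\<^sub>R y) - f (u + t *\<^sub>R x) - f (u + t *\<^sub>R y) + f u =
       t * t * frechet_derivative (\<lambda>z. frechet_derivative f (at z) y) (at p) x"
proof -
  let ?d = "\<lambda>z. frechet_derivative f (at z)"
  have in_ball: "u + a *\<^sub>R x + b *\<^sub>R y \<in> ball u r" if "0 \<le> a" "a \<le> t" "0 \<le> b" "b \<le> t" for a b
  proof -
    have "norm (a *\<^sub>R x + b *\<^sub>R y) \<le> a * norm x + b * norm y"
      using that by (metis abs_of_nonneg norm_scaleR norm_triangle_ineq)
    also have "\<dots> \<le> t * norm x + t * norm y"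
      using that by (intro add_mono mult_right_mono) auto
    finally show ?thesis
      using t by (simp add: dist_norm algebra_simps norm_minus_commute flip: diff_diff_add)
  qed
  have df: "(f has_derivative ?d z) (at z)" if "z \<in> ball u r" for z
    using f that by (rule higher_differentiable_on_has_derivative)
  have ddf: "((\<lambda>z. ?d z y) has_derivative frechet_derivative (\<lambda>z. ?d z y) (at z)) (at z)"
    if "z \<in> ball u r" for z
    using f that by (intro higher_differentiable_on_has_derivative[where n=n and S="ball u r"]) auto
  have "\<exists>s>0. s < t \<and> (f (u + t *\<^sub>R x + t *\<^sub>R y) - f (u + t *\<^sub>R y)) -
       (f (u + t *\<^sub>R x + 0 *\<^sub>R y) - f (u + 0 *\<^sub>R y)) =
       (t - 0) * (?d (u + t *\<^sub>R x + s *\<^sub>R y) y - ?d (u + s *\<^sub>R y) y)"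
    using t in_ball[of t] in_ball[of 0]
    by (intro MVT2 DERIV_diff has_real_derivative_along_line df) auto
  then obtain s where s: "0 < s" "s < t"
    and 1: "f (u + t *\<^sub>R x + t *\<^sub>R y) - f (u + t *\<^sub>R x) - f (u + t *\<^sub>R y) + f u =
      t * (?d (u + t *\<^sub>R x + s *\<^sub>R y) y - ?d (u + s *\<^sub>R y) y)"
    by auto
  have "u + s *\<^sub>R y + a *\<^sub>R x \<in> ball u r" if "0 \<le> a" "a \<le> t" for a
    using in_ball[of a s] that s by (simp add: add_ac)
  then have "\<exists>a>0. a < t \<and> ?d (u + s *\<^sub>R y + t *\<^sub>R x) y - ?d (u + s *\<^sub>R y + 0 *\<^sub>R x) y =
      (t - 0) * frechet_derivative (\<lambda>z. ?d z y) (at (u + s *\<^sub>R y + a *\<^sub>R x)) x"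
    using t by (intro MVT2 has_real_derivative_along_line ddf) auto
  then obtain a where a: "0 < a" "a < t"
    and 2: "?d (u + t *\<^sub>R x + s *\<^sub>R y) y - ?d (u + s *\<^sub>R y) y =
      t * frechet_derivative (\<lambda>z. ?d z y) (at (u + a *\<^sub>R x + s *\<^sub>R y)) x"
    by (auto simp: add_ac)
  show thesis
    using that[of "u + a *\<^sub>R x + s *\<^sub>R y"] in_ball[of a s] a s 1 2 by auto
qed

text \<open>Both mixed derivatives are values, at points near \<open>u\<close>, of the same second difference quotient.\<close>

lemma symmetric_second_derivative:
  fixes f :: "'a::real_normed_vector \<Rightarrow> real"
  assumes S: "open S" "u \<in> S" and f: "higher_differentiable_on S f (Suc (Suc n))"
  shows "frechet_derivative (\<lambda>z. frechet_derivative f (at z) y) (at u) x =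
         frechet_derivative (\<lambda>z. frechet_derivative f (at z) x) (at u) y"
proof -
  define H where "H x y z = frechet_derivative (\<lambda>z. frechet_derivative f (at z) y) (at z) x" for x y z
  have "continuous_on S (H x y)" for x y
    unfolding H_def using f by (auto intro!: higher_differentiable_on_imp_continuous_on)
  then have cont: "isCont (H x y) u" for x y
    using S continuous_on_eq_continuous_at by blast
  have "H x y u = H y x u"
  proof (rule ccontr)
    assume neq: "H x y u \<noteq> H y x u"
    \<comment> \<open>Half the gap: a common value within \<open>\<epsilon>\<close> of both
      derivatives would make the gap smaller than itself.\<close>
    define \<epsilon> where "\<epsilon> = dist (H x y u) (H y x u) / 2"
    have "0 < \<epsilon>" using neq by (simp add: \<epsilon>_def)
    then obtain d1 d2 where d: "0 < d1" "0 < d2"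
      "\<And>z. dist z u < d1 \<Longrightarrow> dist (H x y z) (H x y u) < \<epsilon>"
      "\<And>z. dist z u < d2 \<Longrightarrow> dist (H y x z) (H y x u) < \<epsilon>"
      using cont[of x y] cont[of y x] unfolding continuous_at_eps_delta by metis
    obtain r0 where r0: "0 < r0" "ball u r0 \<subseteq> S" using S openE by blast
    define r where "r = min r0 (min d1 d2)"
    have r: "0 < r" "r \<le> d1" "r \<le> d2" "ball u r \<subseteq> S"
      using d(1,2) r0 by (auto simp: r_def)
    have sub: "higher_differentiable_on (ball u r) f (Suc (Suc n))"
      using f r(4) by (rule higher_differentiable_on_subset)
    \<comment> \<open>The summand \<open>1\<close> keeps the denominator positive even for
      \<open>x = y = 0\<close>.\<close>
    define t where "t = r / (norm x + norm y + 1)"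
    have "0 < norm x + norm y + 1" by (smt (verit) norm_ge_zero)
    then have t: "0 < t" "t * (norm x + norm y) < r"
      using r(1) by (simp_all add: t_def field_simps)
    obtain p where p: "p \<in> ball u r" "f (u + t *\<^sub>R x + t *\<^sub>R y) - f (u + t *\<^sub>R x) - f (u + t *\<^sub>R y) + f u
        = t * t * H x y p"
      using second_difference_mvt[OF sub t] unfolding H_def by blast
    obtain q where q: "q \<in> ball u r" "f (u + t *\<^sub>R y + t *\<^sub>R x) - f (u + t *\<^sub>R y) - f (u + t *\<^sub>R x) + f u
        = t * t * H y x q"
      using second_difference_mvt[OF sub, of t y x] t unfolding H_def by (metis add.commute)
    have "t * t * H x y p = t * t * H y x q"
      using p(2) q(2) by (simp add: algebra_simps)
    then have "H x y p = H y x q" using t(1) by simp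
    moreover have "dist (H x y p) (H x y u) < \<epsilon>" "dist (H y x q) (H y x u) < \<epsilon>"
      using p(1) q(1) r d by (auto simp: dist_commute)
    ultimately show False
      unfolding \<epsilon>_def by (metis dist_commute dist_triangle_half_l less_irrefl)
  qed
  then show ?thesis by (simp add: H_def)
qed

section \<open>Parametrized linear isomorphisms and their inverses\<close>

lemma linear_eq_sum_Basis:
  fixes L :: "'a::euclidean_space \<Rightarrow> 'b::real_vector"
  assumes "linear L"
  shows "L x = (\<Sum>b\<in>Basis. (x \<bullet> b) *\<^sub>R L b)"
proof -
  have "L x = L (\<Sum>b\<in>Basis. (x \<bullet> b) *\<^sub>R b)" by (simp add: euclidean_representation)
  then show ?thesis using assms by (simp add: linear_sum linear_cmul)
qed

text \<open>Finitely many values control the whole operator; this turns continuity of a family at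
  each fixed vector into operator estimates.\<close>

lemma norm_linear_le_sum_Basis:
  fixes L :: "'a::euclidean_space \<Rightarrow> 'b::real_normed_vector"
  assumes "linear L"
  shows "norm (L x) \<le> (\<Sum>b\<in>Basis. norm (L b)) * norm x"
proof -
  have "norm (L x) \<le> (\<Sum>b\<in>Basis. \<bar>x \<bullet> b\<bar> * norm (L b))"
    unfolding linear_eq_sum_Basis[OF assms, of x] by (rule sum_norm_le) simp
  also have "\<dots> \<le> (\<Sum>b\<in>Basis. norm x * norm (L b))"
    by (intro sum_mono mult_right_mono) (auto simp: Basis_le_norm)
  finally show ?thesis by (simp add: sum_distrib_left mult.commute)
qed

text \<open>Isomorphisms \<open>A x\<close> with inverses \<open>R x\<close>, treated one vector at
  a time: regularity is stated for \<open>\<lambda>x. A x b\<close> with \<open>b\<close> fixed, so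
  no operator-valued map has to be differentiated.\<close>

locale linear_iso_family =
  fixes S :: "'c::real_normed_vector set" and A R :: "'c \<Rightarrow> 'a::euclidean_space \<Rightarrow> 'a"
  assumes open_dom: "open S"
    and linear_A: "x \<in> S \<Longrightarrow> linear (A x)"
    and R_A: "x \<in> S \<Longrightarrow> R x (A x c) = c"
    and A_R: "x \<in> S \<Longrightarrow> A x (R x c) = c"
begin

lemma linear_R:
  assumes "x \<in> S"
  shows "linear (R x)"
proof -
  have "inj (A x)" by (metis R_A[OF assms] injI)
  then obtain L where L: "linear L" "L \<circ> A x = id"
    using linear_injective_left_inverse linear_A[OF assms] by blast
  then have "R x = L" using A_R[OF assms] by (metis comp_apply eq_id_iff ext)
  with L show ?thesis by simp
qed

text \<open>Injectivity bounds \<open>A x0\<close> below by some \<open>B\<close>. Near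
  \<open>x0\<close> the perturbation is smaller than \<open>B / 2\<close>, so \<open>A x\<close> is
  bounded below by \<open>B / 2\<close> and its inverse above by \<open>2 / B\<close>.\<close>

lemma eventually_R_bounded:
  assumes cont: "\<And>b. continuous_on S (\<lambda>x. A x b)" and x0: "x0 \<in> S"
  obtains K where "0 < K" "\<forall>\<^sub>F x in nhds x0. x \<in> S \<and> (\<forall>d. norm (R x d) \<le> K * norm d)"
proof -
  have "inj (A x0)" by (metis R_A[OF x0] injI)
  then obtain B where B: "0 < B" "\<And>z. B * norm z \<le> norm (A x0 z)"
    using linear_inj_bounded_below_pos linear_A[OF x0] by blast
  have "isCont (\<lambda>x. A x b) x0" for b
    using cont open_dom x0 continuous_on_eq_continuous_at by blast
  then have "isCont (\<lambda>x. \<Sum>b\<in>Basis. norm (A x b - A x0 b)) x0"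
    by (intro continuous_intros)
  then have "((\<lambda>x. \<Sum>b\<in>Basis. norm (A x b - A x0 b)) \<longlongrightarrow> 0) (nhds x0)"
    by (simp add: continuous_within tendsto_nhds_iff)
  then have "\<forall>\<^sub>F x in nhds x0. (\<Sum>b\<in>Basis. norm (A x b - A x0 b)) < B / 2"
    by (rule order_tendstoD) (use B in simp)
  moreover have "\<forall>\<^sub>F x in nhds x0. x \<in> S"
    using open_dom x0 by (rule eventually_nhds_in_open)
  ultimately have "\<forall>\<^sub>F x in nhds x0. x \<in> S \<and> (\<forall>d. norm (R x d) \<le> 2 / B * norm d)"
  proof eventually_elim
    case (elim x)
    have "norm (R x d) \<le> 2 / B * norm d" for d
    proof -
      define z where "z = R x d"
      have "linear (\<lambda>z. A x z - A x0 z)"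
        using elim x0 by (intro linear_compose_sub linear_A)
      then have "norm (A x z - A x0 z) \<le> (\<Sum>b\<in>Basis. norm (A x b - A x0 b)) * norm z"
        by (rule norm_linear_le_sum_Basis)
      also have "\<dots> \<le> B / 2 * norm z" using elim by (intro mult_right_mono) auto
      finally have "B / 2 * norm z \<le> norm (A x z)"
        using B(2)[of z] norm_triangle_ineq2[of "A x0 z" "A x z"] by (simp add: norm_minus_commute)
      then show ?thesis using B(1) elim A_R[of x d] by (simp add: z_def field_simps)
    qed
    with elim show ?case by blast
  qed
  with that[of "2 / B"] B(1) show thesis by simp
qed

text \<open>The resolvent identity, from which continuity and differentiability of the inverses are
  both derived.\<close>

lemma R_diff_eq:
  assumes "x \<in> S" "x0 \<in> S"
  shows "R x c - R x0 c = - R x (A x (R x0 c) - A x0 (R x0 c))"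
  using assms linear_diff[OF linear_R[OF assms(1)]] by (simp add: R_A A_R)

lemma continuous_on_R:
  assumes cont: "\<And>b. continuous_on S (\<lambda>x. A x b)"
  shows "continuous_on S (\<lambda>x. R x c)"
proof (rule continuous_at_imp_continuous_on, rule ballI)
  fix x0 assume x0: "x0 \<in> S"
  obtain K where K: "0 < K" "\<forall>\<^sub>F x in nhds x0. x \<in> S \<and> (\<forall>d. norm (R x d) \<le> K * norm d)"
    using eventually_R_bounded[OF cont x0] .
  have "isCont (\<lambda>x. A x (R x0 c)) x0"
    using cont open_dom x0 continuous_on_eq_continuous_at by blast
  then have "(\<lambda>x. A x (R x0 c) - A x0 (R x0 c)) \<midarrow>x0\<rightarrow> 0"
    by (simp add: isCont_def LIM_zero)
  then have lim: "(\<lambda>x. K * norm (A x (R x0 c) - A x0 (R x0 c))) \<midarrow>x0\<rightarrow> 0"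
    by (intro tendsto_mult_right_zero tendsto_norm_zero)
  have "\<forall>\<^sub>F x in at x0. norm (R x c - R x0 c) \<le> K * norm (A x (R x0 c) - A x0 (R x0 c))"
    using eventually_nhds_conv_at[THEN iffD1, OF K(2), THEN conjunct1]
    by eventually_elim (metis R_diff_eq x0 norm_minus_cancel)
  then have "(\<lambda>x. R x c - R x0 c) \<midarrow>x0\<rightarrow> 0"
    using lim by (rule Lim_null_comparison)
  then show "isCont (\<lambda>x. R x c) x0"
    by (simp add: isCont_def LIM_zero_iff)
qed

text \<open>By the resolvent identity the error splits into \<open>R x\<close> applied to the
  remainder of \<open>A\<close>, controlled by the local bound on \<open>R\<close>, and
  \<open>R x - R x0\<close> applied to the linear term, controlled by continuity of
  \<open>R\<close>.\<close>

lemma has_derivative_R: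
  assumes cont: "\<And>b. continuous_on S (\<lambda>x. A x b)" and x0: "x0 \<in> S"
    and A': "((\<lambda>x. A x (R x0 c)) has_derivative A') (at x0)"
  shows "((\<lambda>x. R x c) has_derivative (\<lambda>v. - R x0 (A' v))) (at x0)"
proof -
  obtain K where K: "0 < K" "\<forall>\<^sub>F x in nhds x0. x \<in> S \<and> (\<forall>d. norm (R x d) \<le> K * norm d)"
    using eventually_R_bounded[OF cont x0] .
  have bl: "bounded_linear A'" using A' by (rule has_derivative_bounded_linear)
  obtain M where M: "\<And>v. norm (A' v) \<le> norm v * M"
    using bounded_linear.bounded[OF bl] by blast
  define k where "k x = A x (R x0 c) - A x0 (R x0 c)" for x
  define N where "N x = (\<Sum>b\<in>Basis. norm (R x b - R x0 b))" for x
  have R0: "isCont (\<lambda>x. R x b) x0" for b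
    using continuous_on_R[OF cont] open_dom x0 continuous_on_eq_continuous_at by blast
  have N0: "N \<midarrow>x0\<rightarrow> 0"
    unfolding N_def using R0 by (intro tendsto_null_sum tendsto_norm_zero) (simp add: isCont_def LIM_zero)
  have k0: "(\<lambda>x. norm (k x - A' (x - x0)) / norm (x - x0)) \<midarrow>x0\<rightarrow> 0"
    using A' by (simp add: has_derivative_iff_norm k_def)
  have "\<forall>\<^sub>F x in at x0. norm (norm (R x c - R x0 c - - R x0 (A' (x - x0))) / norm (x - x0))
      \<le> K * (norm (k x - A' (x - x0)) / norm (x - x0)) + N x * M"
    using eventually_nhds_conv_at[THEN iffD1, OF K(2), THEN conjunct1] eventually_neq_at_within[of x0]
  proof eventually_elim
    case (elim x)
    have lin: "linear (R x)" "linear (R x0)" using elim x0 linear_R by auto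
    have "R x c - R x0 c - - R x0 (A' (x - x0)) =
        - (R x (k x - A' (x - x0)) + (R x (A' (x - x0)) - R x0 (A' (x - x0))))"
      using R_diff_eq[of x x0 c] elim x0 linear_diff[OF lin(1)] by (simp add: k_def)
    moreover have "norm (R x (A' (x - x0)) - R x0 (A' (x - x0))) \<le> N x * norm (A' (x - x0))"
      unfolding N_def by (rule norm_linear_le_sum_Basis[OF linear_compose_sub[OF lin]])
    moreover have "N x * norm (A' (x - x0)) \<le> N x * (norm (x - x0) * M)"
      unfolding N_def by (intro mult_left_mono M sum_nonneg) auto
    moreover have "norm (R x (k x - A' (x - x0))) \<le> K * norm (k x - A' (x - x0))"
      using elim by blast
    ultimately have "norm (R x c - R x0 c - - R x0 (A' (x - x0)))
        \<le> K * norm (k x - A' (x - x0)) + N x * (norm (x - x0) * M)"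
      by (smt (verit) norm_minus_cancel norm_triangle_ineq)
    then show ?case using elim by (simp add: field_simps)
  qed
  moreover have "(\<lambda>x. K * (norm (k x - A' (x - x0)) / norm (x - x0)) + N x * M) \<midarrow>x0\<rightarrow> 0"
    by (intro tendsto_add_zero tendsto_mult_right_zero tendsto_mult_left_zero k0 N0)
  ultimately have "(\<lambda>x. norm (R x c - R x0 c - - R x0 (A' (x - x0))) / norm (x - x0)) \<midarrow>x0\<rightarrow> 0"
    by (rule Lim_null_comparison)
  moreover have "bounded_linear (\<lambda>v. - R x0 (A' v))"
    using bounded_linear_minus[OF bounded_linear_compose[OF _ bl, of "R x0"]] linear_R[OF x0]
    by (simp add: linear_linear)
  ultimately show ?thesis by (simp add: has_derivative_iff_norm)
qed

text \<open>The derivative of \<open>R\<close> is built from \<open>R\<close> itself and the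
  derivative of \<open>A\<close>, which the induction covers. Expanding the nested applications
  along \<open>Basis\<close> leaves only sums and products, for which closure is available.\<close>

lemma higher_differentiable_on_R:
  assumes "\<And>b. higher_differentiable_on S (\<lambda>x. A x b) n"
  shows "higher_differentiable_on S (\<lambda>x. R x c) n"
  using assms
proof (induction n arbitrary: c)
  case 0
  then show ?case using continuous_on_R by simp
next
  case (Suc n)
  let ?A' = "\<lambda>x d v. frechet_derivative (\<lambda>x. A x d) (at x) v"
  have cont: "continuous_on S (\<lambda>x. A x b)" for b
    using Suc.prems by (rule higher_differentiable_on_imp_continuous_on)
  have R: "higher_differentiable_on S (\<lambda>x. R x c) n" for c
    using Suc.prems[THEN higher_differentiable_on_SucD] by (rule Suc.IH)
  \<comment> \<open>In \<open>?A'\<close> the vector \<open>d\<close> is frozen before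
    differentiating; \<open>R x c\<close> is inserted afterwards, so its own variation with
    \<open>x\<close> does not enter.\<close>
  have A'_sum: "?A' x (R x c) v = (\<Sum>d\<in>Basis. (R x c \<bullet> d) *\<^sub>R ?A' x d v)" if "x \<in> S" for x c v
  proof -
    have "((\<lambda>z. \<Sum>d\<in>Basis. (R x c \<bullet> d) *\<^sub>R A z d) has_derivative
        (\<lambda>v. \<Sum>d\<in>Basis. (R x c \<bullet> d) *\<^sub>R ?A' x d v)) (at x)"
      by (intro has_derivative_sum has_derivative_scaleR_right
          higher_differentiable_on_has_derivative[OF Suc.prems that])
    then have "((\<lambda>z. A z (R x c)) has_derivative
        (\<lambda>v. \<Sum>d\<in>Basis. (R x c \<bullet> d) *\<^sub>R ?A' x d v)) (at x)"
      by (rule has_derivative_transform_within_open[OF _ open_dom that])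
        (metis linear_A linear_eq_sum_Basis)
    from frechet_derivative_at[OF this] show ?thesis by (simp add: fun_eq_iff)
  qed
  show ?case
  proof (rule higher_differentiable_on_SucI[OF open_dom])
    fix x assume x: "x \<in> S"
    have "((\<lambda>x. R x c) has_derivative (\<lambda>v. - R x (?A' x (R x c) v))) (at x)"
      by (rule has_derivative_R[OF cont x higher_differentiable_on_has_derivative[OF Suc.prems x]])
    also have "(\<lambda>v. - R x (?A' x (R x c) v)) = (\<lambda>v. - (\<Sum>b\<in>Basis.
        ((\<Sum>d\<in>Basis. (R x c \<bullet> d) *\<^sub>R ?A' x d v) \<bullet> b) *\<^sub>R R x b))"
      by (simp only: A'_sum[OF x] linear_eq_sum_Basis[OF linear_R[OF x], of "sum _ _"])
    finally show "((\<lambda>x. R x c) has_derivative (\<lambda>v. - (\<Sum>b\<in>Basis.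
        ((\<Sum>d\<in>Basis. (R x c \<bullet> d) *\<^sub>R ?A' x d v) \<bullet> b) *\<^sub>R R x b))) (at x)" .
  next
    fix v
    have "higher_differentiable_on S (\<lambda>x. ?A' x d v) n" for d
      using Suc.prems by auto
    then show "higher_differentiable_on S (\<lambda>x. - (\<Sum>b\<in>Basis.
        ((\<Sum>d\<in>Basis. (R x c \<bullet> d) *\<^sub>R ?A' x d v) \<bullet> b) *\<^sub>R R x b)) n"
      by (intro higher_differentiable_on_bounded_linear[OF open_dom bounded_linear_minus[OF bounded_linear_ident]]
          higher_differentiable_on_bounded_linear[OF open_dom bounded_linear_inner_left]
          higher_differentiable_on_sum[OF open_dom] higher_differentiable_on_scaleR[OF open_dom] R)
  qed
qed

end

text \<open>
  Inducting over all smooth \<open>H\<close> at once avoids a higher-order chain rule: the derivative of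
  \<open>H \<circ> g\<close> is again of the form \<open>K \<circ> g\<close> with \<open>K\<close> smooth.
\<close>

lemma higher_differentiable_on_compose_flow:
  fixes g :: "'c::real_normed_vector \<Rightarrow> 'a::euclidean_space" and H :: "'a \<Rightarrow> 'd::real_normed_vector"
  assumes "open U" "open T" "g ` T \<subseteq> U"
    and G: "\<And>c. smooth_on U (G c)"
    and g: "\<And>y. y \<in> T \<Longrightarrow> (g has_derivative (\<lambda>c. G c (g y))) (at y)"
    and H: "smooth_on U H"
  shows "higher_differentiable_on T (\<lambda>y. H (g y)) n"
  using H
proof (induction n arbitrary: H)
  case 0
  have "continuous_on T g"
    using g by (meson continuous_at_imp_continuous_on has_derivative_continuous)
  moreover have "continuous_on U H"
    using 0 unfolding smooth_on_def by (metis higher_differentiable_on.simps(1))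
  ultimately show ?case
    using \<open>g ` T \<subseteq> U\<close> by (auto intro: continuous_on_compose2)
next
  case (Suc n)
  have H: "higher_differentiable_on U H m" for m
    using Suc.prems by (simp add: smooth_on_def)
  have dH: "(H has_derivative frechet_derivative H (at x)) (at x)" if "x \<in> U" for x
    using H that by (rule higher_differentiable_on_has_derivative)
  \<comment> \<open>The chain rule gives the derivative of \<open>H\<close> at \<open>g y\<close>
    applied to \<open>G c (g y)\<close>; expanding that vector along \<open>Basis\<close> exhibits a
    smooth function of the point \<open>g y\<close>.\<close>
  define K where "K c x = (\<Sum>b\<in>Basis. (G c x \<bullet> b) *\<^sub>R frechet_derivative H (at x) b)" for c x
  have K: "smooth_on U (K c)" for c
    unfolding smooth_on_def
  proof
    fix m
    have "higher_differentiable_on U (\<lambda>x. frechet_derivative H (at x) b) m" for b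
      using H[of "Suc m"] by simp
    moreover have "higher_differentiable_on U (G c) m"
      using G by (simp add: smooth_on_def)
    ultimately show "higher_differentiable_on U (K c) m"
      unfolding K_def
      by (intro higher_differentiable_on_sum[OF \<open>open U\<close>] higher_differentiable_on_scaleR[OF \<open>open U\<close>]
          higher_differentiable_on_bounded_linear[OF \<open>open U\<close> bounded_linear_inner_left])
  qed
  show ?case
  proof (rule higher_differentiable_on_SucI[OF \<open>open T\<close>])
    fix y assume y: "y \<in> T"
    then have gy: "g y \<in> U" using \<open>g ` T \<subseteq> U\<close> by auto
    have "((\<lambda>y. H (g y)) has_derivative (\<lambda>c. frechet_derivative H (at (g y)) (G c (g y)))) (at y)"
      using has_derivative_compose[OF g[OF y] dH[OF gy]] .
    also have "(\<lambda>c. frechet_derivative H (at (g y)) (G c (g y))) = (\<lambda>c. K c (g y))"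
      by (simp only: linear_eq_sum_Basis[OF has_derivative_linear[OF dH[OF gy]], of "G _ (g y)"] K_def)
    finally show "((\<lambda>y. H (g y)) has_derivative (\<lambda>c. K c (g y))) (at y)" .
  qed (rule Suc.IH[OF K])
qed

subsection \<open>Minkowski norms\<close>

text \<open>Removes the coordinates. The open set is left general: the punctured space serves
  Minkowski norms, the whole space serves quadratic energies.\<close>

lemma fundamental_form_eq_second_derivative:
  assumes "open S" "u \<in> S" and E: "higher_differentiable_on S (energy F) (Suc (Suc n))"
  shows "fundamental_form F u x y =
    frechet_derivative (\<lambda>z. frechet_derivative (energy F) (at z) y) (at u) x"
proof -
  let ?d = "\<lambda>z. frechet_derivative (energy F) (at z)"
  let ?dd = "\<lambda>b. frechet_derivative (\<lambda>z. ?d z b) (at u)"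
  have lin: "linear (?d z)" if "z \<in> S" for z
    using has_derivative_linear[OF higher_differentiable_on_has_derivative[OF E that]] .
  have dd: "((\<lambda>z. ?d z b) has_derivative ?dd b) (at u)" for b
    using E \<open>u \<in> S\<close> by (intro higher_differentiable_on_has_derivative[of S _ n]) auto
  have "((\<lambda>z. \<Sum>b\<in>Basis. (y \<bullet> b) *\<^sub>R ?d z b) has_derivative
      (\<lambda>x. \<Sum>b\<in>Basis. (y \<bullet> b) *\<^sub>R ?dd b x)) (at u)"
    by (intro has_derivative_sum has_derivative_scaleR_right dd)
  then have "((\<lambda>z. ?d z y) has_derivative (\<lambda>x. \<Sum>b\<in>Basis. (y \<bullet> b) *\<^sub>R ?dd b x)) (at u)"
    by (rule has_derivative_transform_within_open[OF _ \<open>open S\<close> \<open>u \<in> S\<close>])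
      (simp only: linear_eq_sum_Basis[OF lin, of _ y])
  then have "?dd y x = (\<Sum>b\<in>Basis. (y \<bullet> b) * ?dd b x)"
    by (simp flip: frechet_derivative_at)
  also have "\<dots> = (\<Sum>b\<in>Basis. \<Sum>a\<in>Basis. ?dd b a * (x \<bullet> a) * (y \<bullet> b))"
    by (simp add: linear_eq_sum_Basis[OF has_derivative_linear[OF dd], where x=x] sum_distrib_left mult_ac)
  also have "\<dots> = fundamental_form F u x y"
    unfolding fundamental_form_def partial_deriv_def[abs_def] by (rule sum.swap)
  finally show ?thesis ..
qed

lemma bilinear_fundamental_form: "bilinear (fundamental_form F u)"
  unfolding bilinear_def fundamental_form_def
  by (auto intro!: linearI simp: inner_add_left algebra_simps sum.distrib sum_distrib_left)

lemma energy_nonneg: "0 \<le> energy F u"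
  by (simp add: energy_def)

lemma energy_le_iff: "0 \<le> F u \<Longrightarrow> 0 \<le> G w \<Longrightarrow> energy F u \<le> energy G w \<longleftrightarrow> F u \<le> G w"
  by (simp add: energy_def power_mono_iff)

section \<open>The energy of a Minkowski norm: Euler's identity and convexity\<close>

locale minkowski_space =
  fixes F :: "'a::euclidean_space \<Rightarrow> real"
  assumes minkowski_norm: "minkowski_norm F"
begin

lemma nonneg [simp]: "0 \<le> F u"
  and zero [simp]: "F 0 = 0"
  and scale: "0 < c \<Longrightarrow> F (c *\<^sub>R u) = c * F u"
  and form_pos: "u \<noteq> 0 \<Longrightarrow> x \<noteq> 0 \<Longrightarrow> 0 < fundamental_form F u x x"
  using minkowski_norm by (auto simp: minkowski_norm_def)

abbreviation dE :: "'a \<Rightarrow> 'a \<Rightarrow> real" where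
  "dE u \<equiv> frechet_derivative (energy F) (at u)"

lemma open_nonzero: "open (UNIV - {0::'a})"
  by auto

lemma energy_higher_differentiable: "higher_differentiable_on (UNIV - {0}) (energy F) n"
proof -
  have F: "higher_differentiable_on (UNIV - {0}) F n"
    using minkowski_norm by (auto simp: minkowski_norm_def smooth_on_def)
  have "higher_differentiable_on (UNIV - {0}) (\<lambda>u. 1 / 2 * (F u * F u)) n"
    by (intro higher_differentiable_on_mult[OF open_nonzero] F) simp
  moreover have "energy F = (\<lambda>u. 1 / 2 * (F u * F u))"
    by (auto simp: energy_def power2_eq_square)
  ultimately show ?thesis by simp
qed

lemma dE_higher_differentiable: "higher_differentiable_on (UNIV - {0}) (\<lambda>u. dE u y) n"
  using energy_higher_differentiable[of "Suc n"] by simp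

lemma energy_has_derivative: "u \<noteq> 0 \<Longrightarrow> (energy F has_derivative dE u) (at u)"
  using higher_differentiable_on_has_derivative[OF energy_higher_differentiable] by simp

lemma linear_dE: "u \<noteq> 0 \<Longrightarrow> linear (dE u)"
  using energy_has_derivative has_derivative_linear by blast

lemma form_eq: "u \<noteq> 0 \<Longrightarrow> fundamental_form F u x y = frechet_derivative (\<lambda>z. dE z y) (at u) x"
  using fundamental_form_eq_second_derivative[OF open_nonzero _ energy_higher_differentiable] by simp

lemma dE_has_derivative:
  assumes "u \<noteq> 0"
  shows "((\<lambda>z. dE z y) has_derivative (\<lambda>x. fundamental_form F u x y)) (at u)"
proof -
  have "((\<lambda>z. dE z y) has_derivative frechet_derivative (\<lambda>z. dE z y) (at u)) (at u)"
    using higher_differentiable_on_has_derivative[OF dE_higher_differentiable] assms by simp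
  moreover have "frechet_derivative (\<lambda>z. dE z y) (at u) = (\<lambda>x. fundamental_form F u x y)"
    using form_eq[OF assms] by auto
  ultimately show ?thesis by simp
qed

lemma inner_product_form:
  assumes "u \<noteq> 0"
  shows "inner_product (fundamental_form F u)"
proof -
  have "fundamental_form F u x y = fundamental_form F u y x" for x y
    unfolding form_eq[OF assms]
    by (rule symmetric_second_derivative[OF open_nonzero _ energy_higher_differentiable])
      (use assms in simp)
  then show ?thesis
    using form_pos[OF assms] bilinear_fundamental_form by (simp add: inner_product_def)
qed

lemma energy_scale: "0 < c \<Longrightarrow> energy F (c *\<^sub>R u) = c\<^sup>2 * energy F u"
  by (simp add: energy_def scale power_mult_distrib)

text \<open>The derivative of the energy along the ray through \<open>u\<close> is computed twice,
  by the chain rule and from homogeneity of degree 2.\<close>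

lemma euler:
  assumes "u \<noteq> 0"
  shows "dE u u = 2 * energy F u"
proof -
  have "((\<lambda>s. energy F (u + s *\<^sub>R u)) has_real_derivative dE u u) (at 0)"
    using assms by (intro has_real_derivative_along_line) (simp add: energy_has_derivative)
  moreover have "((\<lambda>s. energy F (u + s *\<^sub>R u)) has_real_derivative 2 * energy F u) (at 0)"
  proof (rule has_field_derivative_transform_within_open)
    show "((\<lambda>s. (1 + s)\<^sup>2 * energy F u) has_real_derivative 2 * energy F u) (at 0)"
      by (auto intro!: derivative_eq_intros)
    \<comment> \<open>Homogeneity concerns positive factors, hence the restriction to
      \<open>s > -1\<close>.\<close>
    show "(1 + s)\<^sup>2 * energy F u = energy F (u + s *\<^sub>R u)" if "s \<in> {-1<..}" for s
      using energy_scale[of "1 + s" u] that by (simp add: scaleR_add_left)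
  qed auto
  ultimately show ?thesis by (rule DERIV_unique)
qed

text \<open>The gradient inequality of convexity, which makes critical points along a fibre into
  minimizers. On a segment avoiding the origin, two mean value steps reduce it to positivity of the
  fundamental form.\<close>

lemma energy_above_tangent:
  assumes "u \<noteq> 0"
  shows "energy F u + dE u (w - u) \<le> energy F w"
proof (cases "\<exists>s\<in>{0..1}. u + s *\<^sub>R (w - u) = 0")
  \<comment> \<open>\<open>E\<close> need not be twice differentiable at \<open>0\<close>; a segment through \<open>0\<close> is handled by Euler's identity.\<close>
  case True
  then obtain s where s: "0 \<le> s" "s \<le> 1" "u + s *\<^sub>R (w - u) = 0" by auto
  with assms have "0 < s" by (cases "s = 0") auto
  have "w - u = (- 1 / s) *\<^sub>R u"
  proof -
    have "s *\<^sub>R (w - u) = - u" using s(3) by (metis add.commute eq_neg_iff_add_eq_0)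
    then have "(1 / s) *\<^sub>R (s *\<^sub>R (w - u)) = (1 / s) *\<^sub>R (- u)" by simp
    then show ?thesis using \<open>0 < s\<close> by simp
  qed
  then have "dE u (w - u) = (- 1 / s) * (2 * energy F u)"
    by (simp only: linear_cmul[OF linear_dE[OF assms]] euler[OF assms] real_scaleR_def)
  \<comment> \<open>Since \<open>s \<le> 1\<close>, the tangent value at \<open>w\<close> is
    nonpositive, while the energy is nonnegative.\<close>
  moreover have "energy F u \<le> (1 / s) * (2 * energy F u)"
    using \<open>0 < s\<close> mult_left_le[OF s(2) energy_nonneg[of F u]] energy_nonneg[of F u]
    by (simp add: pos_le_divide_eq)
  ultimately show ?thesis using energy_nonneg[of F w] by simp
next
  case False
  define d where "d = w - u"
  have nz: "u + s *\<^sub>R d \<noteq> 0" if "0 \<le> s" "s \<le> 1" for s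
    using False that by (auto simp: d_def)
  have "\<exists>z>0. z < 1 \<and> energy F (u + 1 *\<^sub>R d) - energy F (u + 0 *\<^sub>R d) = (1 - 0) * dE (u + z *\<^sub>R d) d"
    using nz by (intro MVT2 has_real_derivative_along_line energy_has_derivative) auto
  then obtain z where z: "0 < z" "z < 1" "energy F w - energy F u = dE (u + z *\<^sub>R d) d"
    by (auto simp: d_def)
  have "\<exists>a>0. a < z \<and> dE (u + z *\<^sub>R d) d - dE (u + 0 *\<^sub>R d) d =
      (z - 0) * fundamental_form F (u + a *\<^sub>R d) d d"
    using nz z by (intro MVT2 has_real_derivative_along_line dE_has_derivative) auto
  then obtain a where a: "0 < a" "a < z"
    "dE (u + z *\<^sub>R d) d - dE u d = z * fundamental_form F (u + a *\<^sub>R d) d d"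
    by auto
  have "0 \<le> fundamental_form F (u + a *\<^sub>R d) d d"
    using form_pos[OF nz, of a d] a z
    by (cases "d = 0") (auto simp: bilinear_lzero[OF bilinear_fundamental_form] less_imp_le)
  then have "0 \<le> z * fundamental_form F (u + a *\<^sub>R d) d d"
    using z by simp
  then show ?thesis using z a by (simp add: d_def)
qed

end

section \<open>Norms induced by inner products\<close>

lemma inner_product_nonneg: "inner_product g \<Longrightarrow> 0 \<le> g x x"
  by (cases "x = 0") (auto simp: inner_product_def bilinear_lzero less_imp_le)

lemma energy_induced_norm: "inner_product g \<Longrightarrow> energy (induced_norm g) = (\<lambda>x. g x x / 2)"
  by (simp add: energy_def induced_norm_def inner_product_nonneg fun_eq_iff)

text \<open>The energy is the quadratic form \<open>g x x / 2\<close>, whose second derivative is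
  \<open>g\<close> at every point; strong convexity is therefore positivity of
  \<open>g\<close>.\<close>

lemma minkowski_norm_induced_norm:
  fixes g :: "'a::euclidean_space \<Rightarrow> 'a \<Rightarrow> real"
  assumes g: "inner_product g"
  shows "minkowski_norm (induced_norm g)"
proof -
  have bil: "bounded_bilinear g" and bl: "bilinear g" and sym: "\<And>x y. g x y = g y x"
    and pos: "\<And>x. x \<noteq> 0 \<Longrightarrow> 0 < g x x"
    using g by (auto simp: inner_product_def bilinear_conv_bounded_bilinear)
  have S: "open (UNIV - {0::'a})" by auto
  have sq: "higher_differentiable_on T (\<lambda>x. g x x) n" if "open T" for T n
    using higher_differentiable_on_linear[OF that bounded_linear_ident]
    by (intro higher_differentiable_on_bounded_bilinear[OF that bil])
  have "higher_differentiable_on (UNIV - {0}) (induced_norm g) n" for n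
    by (rule higher_differentiable_on_cong[OF S _
          higher_differentiable_on_powr[OF S _ sq[OF S], where a="1 / 2"]])
      (auto simp: induced_norm_def powr_half_sqrt less_imp_le pos)
  then have smooth: "smooth_on (UNIV - {0}) (induced_norm g)"
    by (simp add: smooth_on_def)
  have "((\<lambda>x. g x x / 2) has_derivative g z) (at z)" for z
  proof -
    have "((\<lambda>x. 1 / 2 * g x x) has_derivative (\<lambda>y. 1 / 2 * (g z y + g y z))) (at z)"
      by (intro has_derivative_mult_right bounded_bilinear.FDERIV[OF bil] has_derivative_ident)
    then show ?thesis by (simp add: sym[of _ z])
  qed
  then have d: "frechet_derivative (energy (induced_norm g)) (at z) = g z" for z
    using frechet_derivative_at energy_induced_norm[OF g] by metis
  have "frechet_derivative (\<lambda>z. g z y) (at u) = (\<lambda>x. g x y)" for u y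
    by (rule frechet_derivative_at[symmetric], rule bounded_linear_imp_has_derivative,
        rule bounded_bilinear.bounded_linear_left[OF bil])
  moreover have "higher_differentiable_on UNIV (energy (induced_norm g)) (Suc (Suc 0))"
    unfolding energy_induced_norm[OF g] divide_inverse
    by (rule higher_differentiable_on_mult[OF open_UNIV sq[OF open_UNIV] higher_differentiable_on_const])
  ultimately have form: "fundamental_form (induced_norm g) u x y = g x y" for u x y
    by (simp only: fundamental_form_eq_second_derivative[OF open_UNIV UNIV_I] d)
  show ?thesis
    unfolding minkowski_norm_def
    using smooth pos form inner_product_nonneg[OF g]
    by (auto simp: induced_norm_def bilinear_lzero[OF bl] bilinear_lmul[OF bl] bilinear_rmul[OF bl]
        real_sqrt_mult)
qed

subsection \<open>Submersions and their lifts\<close>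

text \<open>\<open>L\<close> is a section of \<open>\<mu>\<close> and, by \<open>g1_L\<close>, its
  adjoint. These two identities are later verified for the derivative of the lift at
  \<open>v\<close>; what remains is linear algebra.\<close>

locale euclidean_lift =
  fixes g1 :: "'a::euclidean_space \<Rightarrow> 'a \<Rightarrow> real" and g2 :: "'b::euclidean_space \<Rightarrow> 'b \<Rightarrow> real"
    and \<mu> :: "'a \<Rightarrow> 'b" and L :: "'b \<Rightarrow> 'a"
  assumes g1: "inner_product g1" and g2: "inner_product g2"
    and linear_\<mu>: "linear \<mu>" and linear_L: "linear L"
    and \<mu>_L: "\<mu> (L b) = b"
    and g1_L: "g1 (L b) z = g2 b (\<mu> z)"
begin

lemma bilinear_g1: "bilinear g1" and g1_sym: "g1 x y = g1 y x" and g1_pos: "x \<noteq> 0 \<Longrightarrow> 0 < g1 x x"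
  using g1 by (auto simp: inner_product_def)

lemma L_horizontal: "L b \<in> horizontal_subspace g1 \<mu>"
  using g2 by (auto simp: horizontal_subspace_def g1_L inner_product_def bilinear_lzero bilinear_rzero)

text \<open>The vertical part \<open>x - L (\<mu> x)\<close> lies in the kernel of
  \<open>\<mu>\<close>; for horizontal \<open>x\<close> it is orthogonal to itself. Hence the
  horizontal subspace is the range of \<open>L\<close>.\<close>

lemma horizontal_iff: "x \<in> horizontal_subspace g1 \<mu> \<longleftrightarrow> x = L (\<mu> x)"
proof
  assume x: "x \<in> horizontal_subspace g1 \<mu>"
  have ker: "\<mu> (x - L (\<mu> x)) = 0"
    by (simp add: linear_diff[OF linear_\<mu>] \<mu>_L)
  then have "g1 x (x - L (\<mu> x)) = 0" "g1 (L (\<mu> x)) (x - L (\<mu> x)) = 0"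
    using x L_horizontal[of "\<mu> x"] by (auto simp: horizontal_subspace_def)
  then have "g1 (x - L (\<mu> x)) (x - L (\<mu> x)) = 0"
    by (simp add: bilinear_lsub[OF bilinear_g1])
  then show "x = L (\<mu> x)"
    using g1_pos[of "x - L (\<mu> x)"] by fastforce
qed (metis L_horizontal)

text \<open>Splits \<open>x\<close> into orthogonal horizontal and vertical parts. Thus
  \<open>\<mu>\<close> does not increase norms, with equality only on the range of
  \<open>L\<close>.\<close>

lemma pythagoras: "g1 x x = g2 (\<mu> x) (\<mu> x) + g1 (x - L (\<mu> x)) (x - L (\<mu> x))"
  by (simp add: bilinear_lsub[OF bilinear_g1] bilinear_rsub[OF bilinear_g1] g1_L g1_sym[of x "L _"] \<mu>_L)

lemma surj_\<mu>: "surj \<mu>"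
  using \<mu>_L by (metis surjI)

lemma euclidean_submersion: "euclidean_submersion g1 g2 \<mu>"
  unfolding euclidean_submersion_def
  using g1 g2 linear_\<mu> surj_\<mu> horizontal_iff g1_L by metis

lemma g1_L_L: "g1 (L b) (L b) = g2 b b"
  by (simp add: g1_L \<mu>_L)

lemma minkowski_submersion: "minkowski_submersion (induced_norm g1) (induced_norm g2) \<mu>"
  unfolding minkowski_submersion_def
proof (intro conjI minkowski_norm_induced_norm g1 g2 linear_\<mu> surj_\<mu> subset_antisym image_subsetI subsetI)
  fix u assume "u \<in> {u. induced_norm g1 u \<le> 1}"
  then show "\<mu> u \<in> {v. induced_norm g2 v \<le> 1}"
    using pythagoras[of u] inner_product_nonneg[OF g1, of "u - L (\<mu> u)"]
    by (simp add: induced_norm_def)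
next
  fix b assume "b \<in> {v. induced_norm g2 v \<le> 1}"
  then have "L b \<in> {u. induced_norm g1 u \<le> 1}"
    by (simp add: induced_norm_def g1_L_L)
  then show "b \<in> \<mu> ` {u. induced_norm g1 u \<le> 1}"
    by (metis \<mu>_L image_eqI)
qed

lemma nonlinear_lift: "nonlinear_lift (induced_norm g1) (induced_norm g2) \<mu> L"
  unfolding nonlinear_lift_def
proof (intro allI conjI impI)
  fix b
  show "\<mu> (L b) = b" by (rule \<mu>_L)
  show "induced_norm g1 (L b) = induced_norm g2 b" by (simp add: induced_norm_def g1_L_L)
  fix u assume "\<mu> u = b \<and> induced_norm g1 u = induced_norm g2 b"
  then have "g1 (u - L b) (u - L b) = 0" "\<mu> u = b"
    using pythagoras[of u] by (auto simp: induced_norm_def)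
  then show "u = L b"
    using g1_pos[of "u - L b"] by fastforce
qed

end

section \<open>Nonlinear lifts of Minkowski submersions\<close>

locale minkowski_lift = N1: minkowski_space F1 + N2: minkowski_space F2
  for F1 :: "'a::euclidean_space \<Rightarrow> real" and F2 :: "'b::euclidean_space \<Rightarrow> real" +
  fixes \<mu> :: "'a \<Rightarrow> 'b" and h :: "'b \<Rightarrow> 'a"
  assumes submersion: "minkowski_submersion F1 F2 \<mu>" and lift: "nonlinear_lift F1 F2 \<mu> h"
begin

lemma linear_\<mu>: "linear \<mu>" and surj_\<mu>: "surj \<mu>"
  and image_ball: "\<mu> ` {u. F1 u \<le> 1} = {v. F2 v \<le> 1}"
  using submersion by (auto simp: minkowski_submersion_def)

lemma \<mu>_h [simp]: "\<mu> (h v) = v" and F1_h [simp]: "F1 (h v) = F2 v"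
  and h_unique: "F1 u = F2 (\<mu> u) \<Longrightarrow> u = h (\<mu> u)"
  using lift by (auto simp: nonlinear_lift_def)

lemma \<mu>_zero [simp]: "\<mu> 0 = 0"
  using linear_\<mu> by (rule linear_0)

lemma h_nonzero: "v \<noteq> 0 \<Longrightarrow> h v \<noteq> 0"
  using \<mu>_h[of v] \<mu>_zero by metis

text \<open>Homogeneity extends the inclusion of unit balls to all vectors.\<close>

lemma norm_\<mu>_le: "F2 (\<mu> u) \<le> F1 u"
proof (rule field_le_epsilon)
  fix e :: real assume "0 < e"
  \<comment> \<open>Dividing by \<open>F1 u + e\<close> instead of \<open>F1 u\<close> avoids a
    vanishing denominator.\<close>
  define c where "c = F1 u + e"
  have c: "0 < c" "F1 u \<le> c" using \<open>0 < e\<close> by (simp_all add: c_def add_nonneg_pos)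
  have "F1 ((1 / c) *\<^sub>R u) \<le> 1"
    using c by (subst N1.scale) (auto simp: field_simps)
  then have "F2 (\<mu> ((1 / c) *\<^sub>R u)) \<le> 1" using image_ball by blast
  then have "1 / c * F2 (\<mu> u) \<le> 1"
    using c N2.scale[of "1 / c"] linear_cmul[OF linear_\<mu>] by simp
  then show "F2 (\<mu> u) \<le> F1 u + e" using c by (simp add: c_def field_simps)
qed

text \<open>First-order condition at a minimum that is global by \<open>norm_\<mu>_le\<close>. On
  the kernel of \<open>\<mu>\<close> it says that \<open>h v\<close> is critical along its
  fibre.\<close>

lemma dE1_lift:
  assumes "v \<noteq> 0"
  shows "N1.dE (h v) z = N2.dE v (\<mu> z)"
proof -
  have "(\<mu> has_derivative \<mu>) (at (h v))"
    using linear_\<mu> by (simp add: bounded_linear_imp_has_derivative linear_linear)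
  from has_derivative_compose[OF this]
  have "((\<lambda>u. energy F2 (\<mu> u)) has_derivative (\<lambda>z. N2.dE v (\<mu> z))) (at (h v))"
    using N2.energy_has_derivative[OF assms] by simp
  then have "((\<lambda>u. energy F1 u - energy F2 (\<mu> u)) has_derivative
      (\<lambda>z. N1.dE (h v) z - N2.dE v (\<mu> z))) (at (h v))"
    by (rule has_derivative_diff[OF N1.energy_has_derivative[OF h_nonzero[OF assms]]])
  moreover have "\<forall>u\<in>UNIV. energy F1 (h v) - energy F2 (\<mu> (h v)) \<le> energy F1 u - energy F2 (\<mu> u)"
    using norm_\<mu>_le by (simp add: energy_def power_mono)
  ultimately have "(\<lambda>z. N1.dE (h v) z - N2.dE v (\<mu> z)) = (\<lambda>z. 0)"
    using differential_zero_maxmin[OF UNIV_I open_UNIV] by blast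
  from fun_cong[OF this, of z] show ?thesis by simp
qed

text \<open>Converse of the first-order condition: the tangent at \<open>u\<close>, evaluated at
  \<open>h (\<mu> u)\<close> in the same fibre, shows that \<open>u\<close> is minimal, and the
  minimizer is unique.\<close>

lemma critical_imp_lift:
  assumes "u \<noteq> 0" "\<And>y. \<mu> y = 0 \<Longrightarrow> N1.dE u y = 0"
  shows "u = h (\<mu> u)"
proof -
  have "N1.dE u (h (\<mu> u) - u) = 0"
    by (rule assms(2)) (simp add: linear_diff[OF linear_\<mu>])
  then have "energy F1 u \<le> energy F1 (h (\<mu> u))"
    using N1.energy_above_tangent[OF assms(1), of "h (\<mu> u)"] by simp
  then have "F1 u \<le> F2 (\<mu> u)"
    by (simp add: energy_le_iff)
  with norm_\<mu>_le[of u] show ?thesis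
    by (intro h_unique) simp
qed

text \<open>The inverse function theorem yields a differential equation for \<open>h\<close>, with
  fields smooth on the whole punctured space; this is the form from which
  \<open>higher_differentiable_on_compose_flow\<close> extracts all orders of smoothness.\<close>

lemma lift_derivative_field:
  assumes "v \<noteq> 0"
  obtains N G where "open N" "v \<in> N" "0 \<notin> N" "\<And>c. smooth_on (UNIV - {0}) (G c)"
    "\<And>w. w \<in> N \<Longrightarrow> (h has_derivative (\<lambda>c. G c (h w))) (at w)"
proof -
  obtain S where S: "linear S" "\<And>b. \<mu> (S b) = b"
    using linear_surjective_right_inverse[OF linear_\<mu> surj_\<mu>] by (metis comp_apply id_apply)
  \<comment> \<open>Projection onto the kernel of \<open>\<mu>\<close> along the range of
    \<open>S\<close>. A vector \<open>S b + Q y\<close> thus records a base component and a kernel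
    component inside \<open>V_1\<close> itself.\<close>
  define Q where "Q x = x - S (\<mu> x)" for x
  have Q: "linear Q" "\<And>x. \<mu> (Q x) = 0" "\<And>y. \<mu> y = 0 \<Longrightarrow> Q y = y"
    unfolding Q_def using S linear_\<mu>
    by (auto intro!: linear_compose_sub linear_ident linear_compose[of \<mu> S, unfolded o_def]
        simp: linear_diff linear_0)
  have \<mu>_form: "\<mu> (S (\<mu> x) + Q y) = \<mu> x" for x y
    by (simp add: linear_add[OF linear_\<mu>] S Q)
  \<comment> \<open>Here \<open>e\<close> represents the functional \<open>l\<close> after
    \<open>Q\<close> in the built-in inner product. If \<open>Q e = 0\<close>, then \<open>e\<close>
    is orthogonal to itself, so \<open>l\<close> vanishes on the kernel of
    \<open>\<mu>\<close>.\<close>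
  have kernel: "l y = 0" if "linear l" "Q (\<Sum>b\<in>Basis. l (Q b) *\<^sub>R b) = 0" "\<mu> y = 0"
    for l :: "'a \<Rightarrow> real" and y
  proof -
    define e where "e = (\<Sum>b\<in>Basis. l (Q b) *\<^sub>R b)"
    have lQ: "linear (\<lambda>y. l (Q y))" using linear_compose[OF Q(1) that(1)] by (simp add: o_def)
    have e: "l (Q y) = e \<bullet> y" for y
      using linear_eq_sum_Basis[OF lQ, of y]
      by (simp add: e_def inner_sum_left inner_commute[of y] mult.commute)
    have "e \<bullet> e = l (Q e)" by (simp add: e)
    also have "\<dots> = 0" using that(1,2) by (simp add: e_def linear_0)
    finally show ?thesis using e[of y] Q(3)[OF that(3)] by simp
  qed
  \<comment> \<open>\<open>\<Phi> u = S w\<close> says that \<open>\<mu> u = w\<close> and that \<open>dE\<^sub>1(u)\<close> vanishes on \<open>ker \<mu>\<close>, i.e. \<open>u = h w\<close>.\<close>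
  define \<Phi> where "\<Phi> u = S (\<mu> u) + Q (\<Sum>b\<in>Basis. N1.dE u (Q b) *\<^sub>R b)" for u
  \<comment> \<open>The derivative of \<open>\<Phi>\<close>: differentiating \<open>dE\<close>
    produces the fundamental form.\<close>
  define A where "A u x = S (\<mu> x) + Q (\<Sum>b\<in>Basis. fundamental_form F1 u x (Q b) *\<^sub>R b)" for u x
  define R where "R u = inv (A u)" for u
  have linear_form: "linear (\<lambda>x. fundamental_form F1 u x y)" "linear (fundamental_form F1 u x)" for u x y
    using bilinear_fundamental_form by (auto simp: bilinear_def)
  have linear_A: "linear (A u)" for u
  proof -
    have "linear (\<lambda>x. \<Sum>b\<in>Basis. fundamental_form F1 u x (Q b) *\<^sub>R b)"
      by (intro linear_compose_sum ballI linear_compose[OF linear_form(1) linear_scaleR_left, unfolded o_def])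
    from linear_compose_add[OF linear_compose[OF linear_\<mu> S(1)] linear_compose[OF this Q(1)]]
    show ?thesis by (simp add: o_def A_def[abs_def])
  qed
  \<comment> \<open>A null vector \<open>x\<close> lies in the kernel of \<open>\<mu>\<close>, and
    pairing with \<open>x\<close> vanishes on that kernel, in particular at \<open>x\<close>;
    positivity gives \<open>x = 0\<close>.\<close>
  have inj_A: "inj (A u)" if "u \<noteq> 0" for u
    unfolding linear_injective_0[OF linear_A]
  proof (intro allI impI)
    fix x assume x: "A u x = 0"
    then have \<mu>x: "\<mu> x = 0" using \<mu>_form[of x] \<mu>_zero by (metis A_def)
    with x have "Q (\<Sum>b\<in>Basis. fundamental_form F1 u x (Q b) *\<^sub>R b) = 0"
      by (simp add: A_def linear_0[OF S(1)])
    from kernel[OF linear_form(2) this \<mu>x] show "x = 0"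
      using N1.form_pos[OF that] by fastforce
  qed
  interpret iso: linear_iso_family "UNIV - {0}" A R
  proof
    fix u :: 'a and c assume "u \<in> UNIV - {0}"
    then have "inj (A u)" using inj_A by simp
    moreover have "surj (A u)" using linear_injective_imp_surjective[OF linear_A calculation refl] .
    ultimately show "R u (A u c) = c" "A u (R u c) = c"
      by (simp_all add: R_def surj_f_inv_f)
  qed (simp_all add: linear_add[OF linear_A] linear_cmul[OF linear_A] N1.open_nonzero)
  have bl: "bounded_linear S" "bounded_linear Q"
    using S(1) Q(1) by (simp_all add: linear_linear)
  have A_smooth: "higher_differentiable_on (UNIV - {0}) (\<lambda>u. A u x) n" for x n
  proof (rule higher_differentiable_on_cong[OF N1.open_nonzero])
    have "higher_differentiable_on (UNIV - {0})
        (\<lambda>u. frechet_derivative (\<lambda>u. N1.dE u (Q b)) (at u) x) n" for b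
      using N1.dE_higher_differentiable[where n="Suc n"] by simp
    then show "higher_differentiable_on (UNIV - {0}) (\<lambda>u. S (\<mu> x) +
        Q (\<Sum>b\<in>Basis. frechet_derivative (\<lambda>u. N1.dE u (Q b)) (at u) x *\<^sub>R b)) n"
      by (intro higher_differentiable_on_add[OF N1.open_nonzero] higher_differentiable_on_const
          higher_differentiable_on_bounded_linear[OF N1.open_nonzero bl(2)]
          higher_differentiable_on_sum[OF N1.open_nonzero]
          higher_differentiable_on_scaleR[OF N1.open_nonzero])
  qed (simp add: A_def N1.form_eq)
  have R_smooth: "higher_differentiable_on (UNIV - {0}) (\<lambda>u. R u c) n" for c n
    by (rule iso.higher_differentiable_on_R[OF A_smooth])
  have Blinfun_A: "blinfun_apply (Blinfun (A u)) = A u" for u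
    using linear_A by (simp add: bounded_linear_Blinfun_apply linear_linear)
  have \<Phi>_deriv: "(\<Phi> has_derivative A u) (at u)" if "u \<noteq> 0" for u
  proof -
    have "((\<lambda>u. S (\<mu> u)) has_derivative (\<lambda>x. S (\<mu> x))) (at u)"
      using linear_compose[OF linear_\<mu> S(1)]
      by (auto intro!: bounded_linear_imp_has_derivative simp: linear_linear o_def)
    then show ?thesis
      unfolding \<Phi>_def[abs_def] A_def[abs_def]
      by (intro has_derivative_add bounded_linear.has_derivative[OF bl(2)] has_derivative_sum
          has_derivative_scaleR_left N1.dE_has_derivative[OF that])
  qed
  have hv: "h v \<noteq> 0" using h_nonzero[OF assms] .
  have cont: "continuous_on (UNIV - {0}) (\<lambda>u. Blinfun (A u))"
    by (rule continuous_on_blinfun_componentwise)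
      (simp add: Blinfun_A higher_differentiable_on_imp_continuous_on[OF A_smooth])
  have inv_hv: "Blinfun (R (h v)) o\<^sub>L Blinfun (A (h v)) = id_blinfun"
    using iso.linear_R[of "h v"] hv
    by (intro blinfun_eqI)
      (simp add: Blinfun_A bounded_linear_Blinfun_apply linear_linear iso.R_A)
  obtain U V g g' where IFT: "open U" "U \<subseteq> UNIV - {0}" "h v \<in> U" "open V" "\<Phi> (h v) \<in> V"
    "homeomorphism U V \<Phi> g"
    "\<And>y. y \<in> V \<Longrightarrow> (g has_derivative g' y) (at y)"
    "\<And>y. y \<in> V \<Longrightarrow> g' y = inv (blinfun_apply (Blinfun (A (g y))))"
  proof (rule inverse_function_theorem[OF N1.open_nonzero _ cont _ inv_hv, of \<Phi>])
    show "(\<Phi> has_derivative blinfun_apply (Blinfun (A u))) (at u)" if "u \<in> UNIV - {0}" for u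
      using \<Phi>_deriv that by (simp add: Blinfun_A)
  qed (use hv that in auto)
  have \<Phi>_h: "\<Phi> (h w) = S w" if "w \<noteq> 0" for w
    by (simp add: \<Phi>_def dE1_lift[OF that] Q linear_0[OF N2.linear_dE[OF that]] linear_0[OF Q(1)])
  \<comment> \<open>The local inverse at \<open>S w\<close> solves the critical equations in the
    fibre over \<open>w\<close>, hence is the lift.\<close>
  have h_eq: "g (S w) = h w" if "S w \<in> V" for w
  proof -
    define u where "u = g (S w)"
    have u: "u \<noteq> 0" "\<Phi> u = S w"
      using IFT(2,6) that by (auto simp: homeomorphism_def u_def)
    then have "\<mu> u = w" using \<mu>_form S(2) by (metis \<Phi>_def)
    moreover have "u = h (\<mu> u)"
    proof (rule critical_imp_lift[OF u(1)])
      fix y assume "\<mu> y = 0"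
      with kernel[OF N1.linear_dE[OF u(1)]] show "N1.dE u y = 0"
        using u(2) \<open>\<mu> u = w\<close> by (simp add: \<Phi>_def)
    qed
    ultimately show ?thesis by (simp add: u_def)
  qed
  \<comment> \<open>The origin is removed so that \<open>h\<close> maps \<open>N\<close> into the
    punctured space.\<close>
  define N where "N = S -` V - {0}"
  show thesis
  \<comment> \<open>Near \<open>v\<close> the lift is the local inverse after \<open>S\<close>, so
    its derivative in direction \<open>c\<close> is the inverse of \<open>A (h w)\<close> applied to
    \<open>S c\<close>.\<close>
  proof (rule that[of N "\<lambda>c u. R u (S c)"])
    have "open (S -` V)"
      using IFT(4) bl(1) by (intro open_vimage) (auto intro: linear_continuous_on)
    then show "open N" unfolding N_def by (intro open_Diff) auto
    show "v \<in> N" "0 \<notin> N"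
      using IFT(5) \<Phi>_h[OF assms] assms by (auto simp: N_def)
    show "smooth_on (UNIV - {0}) (\<lambda>u. R u (S c))" for c
      using R_smooth by (simp add: smooth_on_def)
    fix w assume w: "w \<in> N"
    then have "S w \<in> V" by (simp add: N_def)
    have "(S has_derivative S) (at w)"
      using bl(1) by (rule bounded_linear_imp_has_derivative)
    from has_derivative_compose[OF this IFT(7)[OF \<open>S w \<in> V\<close>]]
    have "((\<lambda>w. g (S w)) has_derivative (\<lambda>c. R (h w) (S c))) (at w)"
      using IFT(8)[OF \<open>S w \<in> V\<close>] h_eq[OF \<open>S w \<in> V\<close>] by (simp add: Blinfun_A R_def)
    then show "(h has_derivative (\<lambda>c. R (h w) (S c))) (at w)"
      by (rule has_derivative_transform_within_open[OF _ \<open>open N\<close> w]) (auto simp: N_def h_eq)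
  qed
qed

section \<open>First-order geometry of the lift at a nonzero vector\<close>

context
  fixes v :: 'b
  assumes v: "v \<noteq> 0"
begin

lemma h_differentiable: "h differentiable at v"
  using lift_derivative_field[OF v] differentiableI by metis

abbreviation dh :: "'b \<Rightarrow> 'a" where
  "dh \<equiv> frechet_derivative h (at v)"

lemma h_has_derivative: "(h has_derivative dh) (at v)"
  using h_differentiable by (simp add: frechet_derivative_works)

lemma \<mu>_dh: "\<mu> (dh b) = b"
proof -
  have "((\<lambda>w. \<mu> (h w)) has_derivative (\<lambda>b. \<mu> (dh b))) (at v)"
    using linear_\<mu> by (intro bounded_linear.has_derivative[OF _ h_has_derivative]) (simp add: linear_linear)
  then have "((\<lambda>w. w) has_derivative (\<lambda>b. \<mu> (dh b))) (at v)" by simp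
  then have "(\<lambda>b. \<mu> (dh b)) = (\<lambda>b. b)"
    using has_derivative_unique has_derivative_ident by blast
  then show ?thesis by (rule fun_cong)
qed

text \<open>With \<open>z\<close> fixed, \<open>dE1_lift\<close> holds on the open set of nonzero
  vectors and can be differentiated in the base point.\<close>

lemma form_dh: "fundamental_form F1 (h v) (dh b) z = fundamental_form F2 v b (\<mu> z)"
proof -
  have "((\<lambda>w. N1.dE (h w) z) has_derivative (\<lambda>b. fundamental_form F1 (h v) (dh b) z)) (at v)"
    using has_derivative_compose[OF h_has_derivative N1.dE_has_derivative[OF h_nonzero[OF v]]] .
  then have "((\<lambda>w. N2.dE w (\<mu> z)) has_derivative (\<lambda>b. fundamental_form F1 (h v) (dh b) z)) (at v)"
    by (rule has_derivative_transform_within_open[OF _ N2.open_nonzero]) (use v dE1_lift in auto)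
  then have "(\<lambda>b. fundamental_form F1 (h v) (dh b) z) = (\<lambda>b. fundamental_form F2 v b (\<mu> z))"
    using has_derivative_unique N2.dE_has_derivative[OF v] by blast
  then show ?thesis by (rule fun_cong)
qed

lemma euclidean_lift_dh: "euclidean_lift (fundamental_form F1 (h v)) (fundamental_form F2 v) \<mu> dh"
  using N1.inner_product_form[OF h_nonzero[OF v]] N2.inner_product_form[OF v] linear_\<mu>
    has_derivative_linear[OF h_has_derivative] \<mu>_dh form_dh
  by (rule euclidean_lift.intro)

text \<open>For \<open>y\<close> in the kernel of \<open>\<mu>\<close>, \<open>dE\<close> in
  direction \<open>y\<close> vanishes on the cone away from the origin; differentiating along a
  curve makes its velocity horizontal. Conversely, a horizontal \<open>x\<close> equals
  \<open>dh (\<mu> x)\<close>, the velocity of a lifted line.\<close>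

lemma tangent_space_range:
  "tangent_space (range h) (h v) = horizontal_subspace (fundamental_form F1 (h v)) \<mu>"
proof (intro subset_antisym subsetI)
  fix x assume "x \<in> tangent_space (range h) (h v)"
  then obtain \<gamma> e where \<gamma>: "0 < e" "\<gamma> ` {-e<..<e} \<subseteq> range h" "\<gamma> 0 = h v"
    "(\<gamma> has_vector_derivative x) (at 0)"
    unfolding tangent_space_def by blast
  have "fundamental_form F1 (h v) x y = 0" if y: "\<mu> y = 0" for y
  proof -
    have "((\<lambda>z. N1.dE z y) has_derivative (\<lambda>x. fundamental_form F1 (h v) x y)) (at (\<gamma> 0))"
      using \<gamma>(3) N1.dE_has_derivative[OF h_nonzero[OF v]] by simp
    from has_derivative_compose[OF \<gamma>(4)[unfolded has_vector_derivative_def] this]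
    have 1: "((\<lambda>t. N1.dE (\<gamma> t) y) has_derivative (\<lambda>s. fundamental_form F1 (h v) (s *\<^sub>R x) y)) (at 0)" .
    have "isCont \<gamma> 0"
      using \<gamma>(4) by (rule has_vector_derivative_continuous)
    \<comment> \<open>A curve point is only known to be some \<open>h w\<close>; near time
      \<open>0\<close> its projection stays close to \<open>v\<close>, which excludes
      \<open>w = 0\<close>.\<close>
    then have "\<forall>\<^sub>F t in nhds 0. \<mu> (\<gamma> t) \<noteq> 0"
    proof -
      have "isCont (\<lambda>t. \<mu> (\<gamma> t)) 0"
        using linear_\<mu> by (intro bounded_linear.isCont[OF _ \<open>isCont \<gamma> 0\<close>]) (simp add: linear_linear)
      then have "((\<lambda>t. \<mu> (\<gamma> t)) \<longlongrightarrow> v) (nhds 0)"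
        by (simp add: continuous_within tendsto_nhds_iff \<gamma>(3))
      then show ?thesis by (rule tendsto_imp_eventually_ne) (rule v)
    qed
    moreover have "\<forall>\<^sub>F t in nhds 0. t \<in> {-e<..<e}"
      using \<gamma>(1) by (intro eventually_nhds_in_open) auto
    ultimately have "\<forall>\<^sub>F t in nhds 0. N1.dE (\<gamma> t) y = 0"
    proof eventually_elim
      case (elim t)
      then obtain w where w: "\<gamma> t = h w" using \<gamma>(2) by blast
      with elim have "w \<noteq> 0" by auto
      then show ?case
        using w y dE1_lift linear_0[OF N2.linear_dE] by simp
    qed
    then obtain T where T: "open T" "0 \<in> T" "\<And>t. t \<in> T \<Longrightarrow> N1.dE (\<gamma> t) y = 0"
      unfolding eventually_nhds by blast
    have "((\<lambda>t. 0) has_derivative (\<lambda>s. fundamental_form F1 (h v) (s *\<^sub>R x) y)) (at (0::real))"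
      by (rule has_derivative_transform_within_open[OF 1 T])
    then have "(\<lambda>s. fundamental_form F1 (h v) (s *\<^sub>R x) y) = (\<lambda>s. 0)"
      using has_derivative_unique has_derivative_const by blast
    from fun_cong[OF this, of 1] show ?thesis by simp
  qed
  then show "x \<in> horizontal_subspace (fundamental_form F1 (h v)) \<mu>"
    by (simp add: horizontal_subspace_def)
next
  fix x assume "x \<in> horizontal_subspace (fundamental_form F1 (h v)) \<mu>"
  then have x: "x = dh (\<mu> x)"
    using euclidean_lift.horizontal_iff[OF euclidean_lift_dh] by blast
  obtain N G where N: "open N" "v \<in> N" "0 \<notin> N" and G: "\<And>c. smooth_on (UNIV - {0}) (G c)"
    and h: "\<And>w. w \<in> N \<Longrightarrow> (h has_derivative (\<lambda>c. G c (h w))) (at w)"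
    by (rule lift_derivative_field[OF v], rule that)
  define p where "p t = v + t *\<^sub>R \<mu> x" for t
  have p: "(p has_derivative (\<lambda>s. s *\<^sub>R \<mu> x)) (at t)" for t
    unfolding p_def by (auto intro!: derivative_eq_intros)
  have "open (p -` N)"
    using N(1) unfolding p_def by (intro open_vimage continuous_intros)
  moreover have "0 \<in> p -` N" using N(2) by (simp add: p_def)
  ultimately obtain e where e: "0 < e" "ball 0 e \<subseteq> p -` N"
    by (rule openE)
  then have pN: "p t \<in> N" if "t \<in> {-e<..<e}" for t
    using that by (auto simp: subset_iff dist_real_def)
  have "higher_differentiable_on {-e<..<e} (\<lambda>t. h (p t)) n" for n
  \<comment> \<open>Along the line \<open>p\<close> a time increment \<open>s\<close> becomes the
    direction \<open>s *\<^sub>R \<mu> x\<close>; with \<open>H\<close> the identity, the conclusion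
    is smoothness of the lifted curve.\<close>
  proof (rule higher_differentiable_on_compose_flow[OF N1.open_nonzero, where H="\<lambda>u. u"
        and G="\<lambda>s. G (s *\<^sub>R \<mu> x)"])
    show "(\<lambda>t. h (p t)) ` {-e<..<e} \<subseteq> UNIV - {0}"
      using pN N(3) h_nonzero by (metis DiffI UNIV_I image_subsetI singletonD)
    show "((\<lambda>t. h (p t)) has_derivative (\<lambda>s. G (s *\<^sub>R \<mu> x) (h (p t)))) (at t)"
      if "t \<in> {-e<..<e}" for t
      using has_derivative_compose[OF p h[OF pN[OF that]]] .
    show "smooth_on (UNIV - {0::'a}) (\<lambda>u. u)"
      unfolding smooth_on_def
      using higher_differentiable_on_linear[OF N1.open_nonzero bounded_linear_ident] by blast
  qed (use G in auto)
  then have "smooth_on {-e<..<e} (\<lambda>t. h (p t))"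
    by (simp add: smooth_on_def)
  moreover have "((\<lambda>t. h (p t)) has_vector_derivative x) (at 0)"
  proof -
    have "((\<lambda>t. h (p t)) has_derivative (\<lambda>s. dh (s *\<^sub>R \<mu> x))) (at 0)"
      using h_has_derivative by (intro has_derivative_compose[OF p]) (simp add: p_def)
    then show ?thesis
      using x linear_cmul[OF has_derivative_linear[OF h_has_derivative]]
      by (simp add: has_vector_derivative_def)
  qed
  moreover have "h (p 0) = h v" by (simp add: p_def)
  ultimately show "x \<in> tangent_space (range h) (h v)"
    unfolding tangent_space_def using e(1) by blast
qed

end

end

theorem proposition5:
  fixes F1 :: "'a::euclidean_space \<Rightarrow> real"
    and F2 :: "'b::euclidean_space \<Rightarrow> real"
    and \<mu> :: "'a \<Rightarrow> 'b"
    and h :: "'b \<Rightarrow> 'a"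
    and v :: 'b
  assumes "minkowski_submersion F1 F2 \<mu>"
    and "nonlinear_lift F1 F2 \<mu> h"
    and "v \<noteq> 0"
  shows "tangent_space (range h) (h v) =
           horizontal_subspace (fundamental_form F1 (h v)) \<mu> \<and>
         euclidean_submersion (fundamental_form F1 (h v)) (fundamental_form F2 v) \<mu> \<and>
         (h differentiable (at v) \<and>
          minkowski_submersion (induced_norm (fundamental_form F1 (h v)))
            (induced_norm (fundamental_form F2 v)) \<mu> \<and>
          nonlinear_lift (induced_norm (fundamental_form F1 (h v)))
            (induced_norm (fundamental_form F2 v)) \<mu> (frechet_derivative h (at v)))"
proof -
  interpret minkowski_lift F1 F2 \<mu> h
    using assms by unfold_locales (auto simp: minkowski_submersion_def)
  \<comment> \<open>Instantiating \<open>L\<close> by the derivative of the lift makes the linear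
    algebra of the locale deliver claims (ii) and (iii).\<close>
  interpret euclidean_lift "fundamental_form F1 (h v)" "fundamental_form F2 v" \<mu>
    "frechet_derivative h (at v)"
    using assms(3) by (rule euclidean_lift_dh)
  show ?thesis
    using tangent_space_range h_differentiable assms(3) euclidean_submersion
      minkowski_submersion nonlinear_lift by blast
qed

end
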